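(* Let $X$ be a poset, let $\mathcal{F}\colon X\to \mathrm{Ab}$ be a functor and let $A\subseteq X$ be such that $X-A$ is an antichain. Then the inclusion maps $i_x\colon (C_x,\widehat C_x)\to (X,A)$, $x\in X-A$, induce isomorphisms $$\bigoplus_{x\in X-A}H_n(C_x,\widehat C_x;\mathcal{F}|_{C_x})\cong H_n(X,A;\mathcal{F})$$ for all $n\in\mathbb{N}_0$.
   Context: $\mathrm{Ab}$ is the category of abelian groups. A poset $X$ is regarded as a small category with a unique morphism $x\to y$ iff $x\le y$; functors are covariant. For $x\in X$, $C_x=\{y\in X: y\le x \text{ or } y\ge x\}$ and $\widehat C_x=C_x-\{x\}$. For $n\ge 0$, an $n$-chain of $X$ is a totally ordered subset of cardinality $n+1$; $\mathrm{Ch}_n(X)$ is the set of $n$-chains. For a functor $\mathcal{F}\colon X\to\mathrm{Ab}$, $H_n(X;\mathcal{F})$ is the homology of the chain complex $C(X;\mathcal{F})$ with $C_n(X;\mathcal{F})=\bigoplus_{\sigma\in \mathrm{Ch}_n(X)}\mathcal{F}(\min\sigma)$ for $n\geq 0$ (and $0$ for $n<0$), whose differential for $n\geq 1$ is given, for $\sigma=\{\sigma_0<\dots<\sigma_n\}$ and $g\in\mathcal{F}(\sigma_0)$, by $d(g\sigma)=\mathcal{F}(\sigma_0<\sigma_1)(g)\,(\sigma-\{\sigma_0\})+\sum_{i=1}^n(-1)^i g\,(\sigma-\{\sigma_i\})$. For a subposet $A\subseteq X$, $H_n(X,A;\mathcal{F})$ is the homology of the quotient complex $C(X;\mathcal{F})/C(A;\mathcal{F}|_A)$.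 *)

theory Defs
  imports "HOL-Algebra.Free_Abelian_Groups"
begin

text \<open>
  A poset is a subset \<open>X\<close> of a type of class \<open>order\<close>, with the induced order.
  Abelian groups are commutative groups of HOL-Algebra, hence written multiplicatively:
  sums appear as products, and the sign \<open>(-1)\<^sup>i\<close> as an integer power.
\<close>

subsection \<open>Functors to abelian groups\<close>

text \<open>\<open>F\<close> is the action on objects; \<open>f x y\<close> is the value on the morphism \<open>x \<rightarrow> y\<close>, relevant for
  \<open>x \<le> y\<close> only.\<close>

definition ab_functor ::
  "'a::order set \<Rightarrow> ('a \<Rightarrow> 'b monoid) \<Rightarrow> ('a \<Rightarrow> 'a \<Rightarrow> 'b \<Rightarrow> 'b) \<Rightarrow> bool" where
  "ab_functor X F f \<longleftrightarrow>
     (\<forall>x\<in>X. comm_group (F x)) \<and>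
     (\<forall>x\<in>X. \<forall>y\<in>X. x \<le> y \<longrightarrow> f x y \<in> hom (F x) (F y)) \<and>
     (\<forall>x\<in>X. \<forall>g\<in>carrier (F x). f x x g = g) \<and>
     (\<forall>x\<in>X. \<forall>y\<in>X. \<forall>z\<in>X. x \<le> y \<longrightarrow> y \<le> z \<longrightarrow>
        (\<forall>g\<in>carrier (F x). f y z (f x y g) = f x z g))"

subsection \<open>Chains of a poset\<close>

definition antichain :: "'a::order set \<Rightarrow> bool" where
  "antichain S \<longleftrightarrow> (\<forall>x\<in>S. \<forall>y\<in>S. x \<le> y \<longrightarrow> x = y)"

definition star :: "'a::order set \<Rightarrow> 'a \<Rightarrow> 'a set" where
  "star X x = {y \<in> X. y \<le> x \<or> y \<ge> x}"

definition punctured_star :: "'a::order set \<Rightarrow> 'a \<Rightarrow> 'a set" where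
  "punctured_star X x = star X x - {x}"

text \<open>Degrees are integers. As the empty set is excluded, there are no chains of negative degree,
  so that the chain groups below are trivial there.\<close>

definition nchains :: "'a::order set \<Rightarrow> int \<Rightarrow> 'a set set" where
  "nchains X n = {\<sigma>. \<sigma> \<subseteq> X \<and> \<sigma> \<noteq> {} \<and> finite \<sigma> \<and>
                     Complete_Partial_Order.chain (\<le>) \<sigma> \<and> int (card \<sigma>) = n + 1}"

text \<open>The elements of a chain are numbered \<open>\<sigma>\<^sub>0 < \<dots> < \<sigma>\<^sub>n\<close>.\<close>

definition vertex :: "'a::order set \<Rightarrow> nat \<Rightarrow> 'a" where
  "vertex \<sigma> i = (THE x. x \<in> \<sigma> \<and> card {y \<in> \<sigma>. y < x} = i)"

definition chain_min :: "'a::order set \<Rightarrow> 'a" where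
  "chain_min \<sigma> = (LEAST x. x \<in> \<sigma>)"

subsection \<open>The chain complex of a poset with coefficients\<close>

definition chain_group :: "'a::order set \<Rightarrow> ('a \<Rightarrow> 'b monoid) \<Rightarrow> int \<Rightarrow> ('a set \<Rightarrow> 'b) monoid" where
  "chain_group X F n = sum_group (nchains X n) (\<lambda>\<sigma>. F (chain_min \<sigma>))"

text \<open>The element \<open>g\<sigma>\<close> of the direct sum.\<close>

definition simplex ::
  "'a::order set \<Rightarrow> ('a \<Rightarrow> 'b monoid) \<Rightarrow> int \<Rightarrow> 'b \<Rightarrow> 'a set \<Rightarrow> ('a set \<Rightarrow> 'b)" where
  "simplex X F n g \<sigma> = (\<lambda>\<tau>\<in>nchains X n. if \<tau> = \<sigma> then g else \<one>\<^bsub>F (chain_min \<tau>)\<^esub>)"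

definition simplex_boundary ::
  "'a::order set \<Rightarrow> ('a \<Rightarrow> 'b monoid) \<Rightarrow> ('a \<Rightarrow> 'a \<Rightarrow> 'b \<Rightarrow> 'b) \<Rightarrow> int \<Rightarrow>
   'b \<Rightarrow> 'a set \<Rightarrow> ('a set \<Rightarrow> 'b)" where
  "simplex_boundary X F f n g \<sigma> =
     simplex X F (n - 1) (f (vertex \<sigma> 0) (vertex \<sigma> 1) g) (\<sigma> - {vertex \<sigma> 0})
       \<otimes>\<^bsub>chain_group X F (n - 1)\<^esub>
     finprod (chain_group X F (n - 1))
       (\<lambda>i. simplex X F (n - 1) g (\<sigma> - {vertex \<sigma> i})
              [^]\<^bsub>chain_group X F (n - 1)\<^esub> ((- 1) ^ i :: int))
       {1..nat n}"

text \<open>The differential is the additive extension: \<open>c = \<Sum>\<^sub>\<sigma> c(\<sigma>)\<sigma>\<close> has only finitely many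
  nontrivial terms, and \<open>gfinprod\<close> is the product over these.\<close>

definition boundary ::
  "'a::order set \<Rightarrow> ('a \<Rightarrow> 'b monoid) \<Rightarrow> ('a \<Rightarrow> 'a \<Rightarrow> 'b \<Rightarrow> 'b) \<Rightarrow> int \<Rightarrow>
   ('a set \<Rightarrow> 'b) \<Rightarrow> ('a set \<Rightarrow> 'b)" where
  "boundary X F f n c =
     (if n \<ge> 1
      then gfinprod (chain_group X F (n - 1)) (\<lambda>\<sigma>. simplex_boundary X F f n (c \<sigma>) \<sigma>) (nchains X n)
      else \<one>\<^bsub>chain_group X F (n - 1)\<^esub>)"

subsection \<open>Homology of a complex of abelian groups\<close>

text \<open>If \<open>h\<close> maps a subgroup \<open>M\<close> into the subgroup \<open>N\<close> of \<open>G\<close>, the homomorphism it induces on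
  quotients sends the coset of \<open>u\<close> modulo \<open>M\<close> to the coset of \<open>h u\<close> modulo \<open>N\<close>, which does not
  depend on the representative.\<close>

definition coset_map :: "'d monoid \<Rightarrow> 'd set \<Rightarrow> ('c \<Rightarrow> 'd) \<Rightarrow> 'c set \<Rightarrow> 'd set" where
  "coset_map G N h U = (\<Union>u\<in>U. N #>\<^bsub>G\<^esub> h u)"

definition cycles :: "(int \<Rightarrow> 'c monoid) \<Rightarrow> (int \<Rightarrow> 'c \<Rightarrow> 'c) \<Rightarrow> int \<Rightarrow> 'c set" where
  "cycles G d n = kernel (G n) (G (n - 1)) (d n)"

definition boundaries :: "(int \<Rightarrow> 'c monoid) \<Rightarrow> (int \<Rightarrow> 'c \<Rightarrow> 'c) \<Rightarrow> int \<Rightarrow> 'c set" where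
  "boundaries G d n = d (n + 1) ` carrier (G (n + 1))"

definition homology :: "(int \<Rightarrow> 'c monoid) \<Rightarrow> (int \<Rightarrow> 'c \<Rightarrow> 'c) \<Rightarrow> int \<Rightarrow> 'c set monoid" where
  "homology G d n = subgroup_generated (G n) (cycles G d n) Mod boundaries G d n"

subsection \<open>Relative homology\<close>

text \<open>\<open>C\<^sub>n(A)\<close> consists of functions on \<open>nchains A n\<close>; it is embedded in \<open>C\<^sub>n(X)\<close> by extending
  them trivially.\<close>

definition chain_incl ::
  "'a::order set \<Rightarrow> 'a set \<Rightarrow> ('a \<Rightarrow> 'b monoid) \<Rightarrow> int \<Rightarrow> ('a set \<Rightarrow> 'b) \<Rightarrow> ('a set \<Rightarrow> 'b)" where
  "chain_incl A X F n c =
     (\<lambda>\<tau>\<in>nchains X n. if \<tau> \<in> nchains A n then c \<tau> else \<one>\<^bsub>F (chain_min \<tau>)\<^esub>)"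

definition subchains ::
  "'a::order set \<Rightarrow> 'a set \<Rightarrow> ('a \<Rightarrow> 'b monoid) \<Rightarrow> int \<Rightarrow> ('a set \<Rightarrow> 'b) set" where
  "subchains X A F n = chain_incl A X F n ` carrier (chain_group A F n)"

definition rel_chain_group ::
  "'a::order set \<Rightarrow> 'a set \<Rightarrow> ('a \<Rightarrow> 'b monoid) \<Rightarrow> int \<Rightarrow> ('a set \<Rightarrow> 'b) set monoid" where
  "rel_chain_group X A F n = chain_group X F n Mod subchains X A F n"

definition rel_boundary ::
  "'a::order set \<Rightarrow> 'a set \<Rightarrow> ('a \<Rightarrow> 'b monoid) \<Rightarrow> ('a \<Rightarrow> 'a \<Rightarrow> 'b \<Rightarrow> 'b) \<Rightarrow> int \<Rightarrow>
   ('a set \<Rightarrow> 'b) set \<Rightarrow> ('a set \<Rightarrow> 'b) set" where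
  "rel_boundary X A F f n =
     coset_map (chain_group X F (n - 1)) (subchains X A F (n - 1)) (boundary X F f n)"

definition rel_homology ::
  "'a::order set \<Rightarrow> 'a set \<Rightarrow> ('a \<Rightarrow> 'b monoid) \<Rightarrow> ('a \<Rightarrow> 'a \<Rightarrow> 'b \<Rightarrow> 'b) \<Rightarrow> int \<Rightarrow>
   ('a set \<Rightarrow> 'b) set set monoid" where
  "rel_homology X A F f n = homology (rel_chain_group X A F) (rel_boundary X A F f) n"

text \<open>The maps induced by an inclusion of pairs \<open>(Y, B) \<subseteq> (X, A)\<close>, first on relative chains, then
  on relative homology. \<open>B\<close> enters only through their domains.\<close>

definition rel_chain_incl ::
  "'a::order set \<Rightarrow> 'a set \<Rightarrow> 'a set \<Rightarrow> ('a \<Rightarrow> 'b monoid) \<Rightarrow> int \<Rightarrow>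
   ('a set \<Rightarrow> 'b) set \<Rightarrow> ('a set \<Rightarrow> 'b) set" where
  "rel_chain_incl Y X A F n =
     coset_map (chain_group X F n) (subchains X A F n) (chain_incl Y X F n)"

definition rel_homology_incl ::
  "'a::order set \<Rightarrow> 'a set \<Rightarrow> 'a set \<Rightarrow> ('a \<Rightarrow> 'b monoid) \<Rightarrow>
   ('a \<Rightarrow> 'a \<Rightarrow> 'b \<Rightarrow> 'b) \<Rightarrow> int \<Rightarrow> ('a set \<Rightarrow> 'b) set set \<Rightarrow> ('a set \<Rightarrow> 'b) set set" where
  "rel_homology_incl Y X A F f n =
     coset_map (rel_chain_group X A F n)
       (boundaries (rel_chain_group X A F) (rel_boundary X A F f) n)
       (rel_chain_incl Y X A F n)"

lemma inclusion_of_pairs: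
  assumes "A \<subseteq> X" "antichain (X - A)" "x \<in> X - A"
  shows "star X x \<subseteq> X" "punctured_star X x \<subseteq> A" "punctured_star X x \<subseteq> star X x"
  using assms unfolding antichain_def star_def punctured_star_def by blast+

end

theory Submission
  imports Defs
begin

text \<open>
  As \<open>X - A\<close> is an antichain, a chain of \<open>X\<close> not contained in \<open>A\<close> meets \<open>X - A\<close> in exactly one
  point \<open>x\<close>; it then lies in \<open>C\<^sub>x\<close> but not in the punctured star. Hence the inclusions already
  identify the relative chain groups of \<open>(X, A)\<close> with the direct sum of those of the pairs
  \<open>(C\<^sub>x, C\<^sub>x - {x})\<close>, the projections being restriction of chains to \<open>C\<^sub>x\<close>. The inclusions are
  chain maps, hence so are the projections, and the decomposition passes to homology.
\<close>

subsection \<open>Direct sum decompositions\<close>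

text \<open>Restriction to \<open>C_x\<close> does not commute with the differential on absolute
  chains, since a chain outside \<open>C_x\<close> can have a face inside it. Such a face misses
  \<open>x\<close>, so the defect disappears in the relative complex. Instead of tracking it,
  compatibility of the projections is derived formally: an element is the sum of its components, the
  differential is additive and respects the inclusions, so the components of a differential are the
  differentials of the components. One criterion serves twice. Relative chains and their homology
  are both quotients of one subgroup by another (all chains by subchains, cycles by boundaries), and
  inclusions and projections that respect both subgroups descend to such a quotient. As
  \<open>X - A\<close> may be infinite, the criterion also asks that every element have only
  finitely many nontrivial components. For chains this holds because the support consists of
  finitely many finite sets.\<close>

lemma (in comm_monoid) hom_finprod:
  assumes "comm_group H" "group G" "h \<in> hom G H" "u \<in> I \<rightarrow> carrier G"
  shows "h (finprod G u I) = finprod H (\<lambda>i. h (u i)) I"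
proof -
  interpret H: comm_group H by fact
  have one: "h \<one> = \<one>\<^bsub>H\<^esub>"
    using assms by (simp add: hom_one H.is_group)
  show ?thesis
    using assms(4)
  \<comment> \<open>Over an infinite index set both products are the unit by convention, so no
    finiteness assumption on \<open>I\<close> arises.\<close>
  proof (induction I rule: infinite_finite_induct)
    case (insert i I)
    then show ?case
      using assms(3) by (simp add: hom_mult Pi_iff hom_in_carrier)
  qed (use one in auto)
qed

lemma (in comm_group) hom_gfinprod:
  assumes "comm_group H" "h \<in> hom G H" "u \<in> I \<rightarrow> carrier G" "finite {i \<in> I. u i \<noteq> \<one>}"
  shows "h (gfinprod G u I) = gfinprod H (\<lambda>i. h (u i)) I"
proof -
  interpret H: comm_group H by fact
  have one: "h \<one> = \<one>\<^bsub>H\<^esub>"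
    using assms by (simp add: hom_one H.is_group is_group)
  have cl: "(\<lambda>i. h (u i)) \<in> I \<rightarrow> carrier H"
    using assms by (auto intro: hom_in_carrier)
  have "h (gfinprod G u I) = h (finprod G u {i \<in> I. u i \<noteq> \<one>})"
    using assms(4) by (simp add: gfinprod_def)
  also have "\<dots> = finprod H (\<lambda>i. h (u i)) {i \<in> I. u i \<noteq> \<one>}"
    using assms by (intro hom_finprod is_group) auto
  also have "\<dots> = gfinprod H (\<lambda>i. h (u i)) {i \<in> I. u i \<noteq> \<one>}"
    using assms(4) cl by (intro H.gfinprod_eq_finprod [symmetric]) auto
  \<comment> \<open>\<open>h\<close> may send nontrivial factors to the unit, so the support on the
    right can be smaller than the set indexing the previous product.\<close>
  also have "\<dots> = gfinprod H (\<lambda>i. h (u i)) I"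
    using cl one by (intro H.gfinprod_mono_neutral_cong_left) auto
  finally show ?thesis .
qed

text \<open>Commutativity lets the factors be regrouped. Together with \<open>int_pow_hom\<close>,
  which handles the signs, this makes the alternating sum over faces additive in the
  coefficient.\<close>

lemma (in comm_group) hom_finprod_pointwise:
  assumes "\<And>i. i \<in> I \<Longrightarrow> h i \<in> hom H G"
  shows "(\<lambda>g. finprod G (\<lambda>i. h i g) I) \<in> hom H G"
proof (rule homI)
  fix g assume "g \<in> carrier H"
  then show "finprod G (\<lambda>i. h i g) I \<in> carrier G"
    using assms by (auto intro!: finprod_closed intro: hom_in_carrier)
next
  fix g g' assume g: "g \<in> carrier H" "g' \<in> carrier H"
  have "finprod G (\<lambda>i. h i (g \<otimes>\<^bsub>H\<^esub> g')) I = finprod G (\<lambda>i. h i g \<otimes> h i g') I"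
    using g assms by (intro finprod_cong') (auto simp: hom_mult intro!: m_closed hom_in_carrier [OF assms])
  also have "\<dots> = finprod G (\<lambda>i. h i g) I \<otimes> finprod G (\<lambda>i. h i g') I"
    using g assms by (intro finprod_multf) (auto intro: hom_in_carrier [OF assms])
  finally show "finprod G (\<lambda>i. h i (g \<otimes>\<^bsub>H\<^esub> g')) I
      = finprod G (\<lambda>i. h i g) I \<otimes> finprod G (\<lambda>i. h i g') I" .
qed

lemma (in comm_group) int_pow_hom: "(\<lambda>x. x [^] (k::int)) \<in> hom G G"
  by (rule homI) (auto simp: int_pow_distrib)

text \<open>Serves to show that a sum of boundaries is a boundary. The unit, which is the default
  value for infinite support, lies in \<open>S\<close> as well.\<close>

lemma (in comm_monoid) gfinprod_in_submonoid:
  assumes "submonoid S G" "\<And>i. i \<in> I \<Longrightarrow> u i \<in> S"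
  shows "gfinprod G u I \<in> S"
proof -
  interpret S: submonoid S G by fact
  have "finprod G u J \<in> S" if "J \<subseteq> I" for J
    using that
  proof (induction J rule: infinite_finite_induct)
    case (insert i J)
    then have "u \<in> J \<rightarrow> carrier G" "u i \<in> carrier G" "u i \<in> S"
      using assms(2) S.subset by auto
    then show ?case
      using insert by auto
  qed auto
  then show ?thesis
    by (simp add: gfinprod_def)
qed

lemma (in comm_monoid) gfinprod_singleton:
  assumes "i \<in> I" "u i \<in> carrier G" "\<And>j. j \<in> I \<Longrightarrow> j \<noteq> i \<Longrightarrow> u j = \<one>"
  shows "gfinprod G u I = u i"
proof -
  have "gfinprod G u I = gfinprod G u {i}"
    using assms by (intro gfinprod_mono_neutral_cong_right) (auto simp: Pi_iff, metis one_closed)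
  then show ?thesis
    using assms by simp
qed

section \<open>Direct sums given by inclusions and projections\<close>

text \<open>Describing a direct sum by maps in both directions, rather than by an isomorphism,
  leaves conditions on single elements, which can be checked on representatives of cosets.
  \<open>finite_proj\<close> is what separates the direct sum from the product, and
  \<open>proj_jointly_inj\<close> says that the summands exhaust \<open>E\<close>.\<close>

locale direct_sum_decomposition =
  fixes I :: "'i set" and D :: "'i \<Rightarrow> 'c monoid" and E :: "'d monoid"
    and \<phi> :: "'i \<Rightarrow> 'c \<Rightarrow> 'd" and \<rho> :: "'i \<Rightarrow> 'd \<Rightarrow> 'c"
  assumes comm_group_sum: "comm_group E"
    and comm_group_summand: "x \<in> I \<Longrightarrow> comm_group (D x)"
    and incl_hom: "x \<in> I \<Longrightarrow> \<phi> x \<in> hom (D x) E"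
    and proj_hom: "x \<in> I \<Longrightarrow> \<rho> x \<in> hom E (D x)"
    and proj_incl: "x \<in> I \<Longrightarrow> u \<in> carrier (D x) \<Longrightarrow> \<rho> x (\<phi> x u) = u"
    and proj_incl_other:
      "x \<in> I \<Longrightarrow> y \<in> I \<Longrightarrow> x \<noteq> y \<Longrightarrow> u \<in> carrier (D x) \<Longrightarrow> \<rho> y (\<phi> x u) = \<one>\<^bsub>D y\<^esub>"
    and finite_proj: "v \<in> carrier E \<Longrightarrow> finite {x \<in> I. \<rho> x v \<noteq> \<one>\<^bsub>D x\<^esub>}"
    and proj_jointly_inj:
      "v \<in> carrier E \<Longrightarrow> (\<And>x. x \<in> I \<Longrightarrow> \<rho> x v = \<one>\<^bsub>D x\<^esub>) \<Longrightarrow> v = \<one>\<^bsub>E\<^esub>"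
begin

sublocale E: comm_group E
  by (rule comm_group_sum)

lemma group_summand [simp]: "x \<in> I \<Longrightarrow> group (D x)"
  using comm_group_summand by (simp add: comm_group_def)

lemma incl_closed [simp]: "x \<in> I \<Longrightarrow> u \<in> carrier (D x) \<Longrightarrow> \<phi> x u \<in> carrier E"
  by (rule hom_in_carrier [OF incl_hom])

lemma proj_closed [simp]: "x \<in> I \<Longrightarrow> v \<in> carrier E \<Longrightarrow> \<rho> x v \<in> carrier (D x)"
  by (rule hom_in_carrier [OF proj_hom])

lemma proj_sum:
  assumes "y \<in> I" "h \<in> carrier (sum_group I D)"
  shows "\<rho> y (gfinprod E (\<lambda>x. \<phi> x (h x)) I) = h y"
proof -
  interpret Dy: comm_group "D y" using assms comm_group_summand by simp
  have h: "\<And>x. x \<in> I \<Longrightarrow> h x \<in> carrier (D x)" and fin: "finite {x \<in> I. h x \<noteq> \<one>\<^bsub>D x\<^esub>}"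
    using assms by (auto simp: carrier_sum_group)
  have "finite {x \<in> I. \<phi> x (h x) \<noteq> \<one>\<^bsub>E\<^esub>}"
    by (rule finite_subset [OF _ fin]) (auto simp: hom_one [OF incl_hom])
  then have "\<rho> y (gfinprod E (\<lambda>x. \<phi> x (h x)) I) = gfinprod (D y) (\<lambda>x. \<rho> y (\<phi> x (h x))) I"
    using assms h by (intro E.hom_gfinprod) (auto simp: comm_group_summand proj_hom)
  also have "\<dots> = \<rho> y (\<phi> y (h y))"
    using assms h by (intro Dy.gfinprod_singleton) (auto simp: proj_incl_other proj_incl)
  finally show ?thesis
    using assms h by (simp add: proj_incl)
qed

lemma proj_in_sum_group:
  assumes "v \<in> carrier E"
  shows "(\<lambda>x\<in>I. \<rho> x v) \<in> carrier (sum_group I D)"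
  using assms finite_proj [OF assms]
  by (auto simp: carrier_sum_group conj_commute cong: rev_conj_cong)

lemma sum_closed:
  assumes "h \<in> carrier (sum_group I D)"
  shows "gfinprod E (\<lambda>x. \<phi> x (h x)) I \<in> carrier E"
  using assms by (intro E.gfinprod_closed) (auto simp: carrier_sum_group PiE_iff)

text \<open>By \<open>proj_sum\<close>, \<open>v\<close> and the sum of its components have the same
  projections, so their quotient has trivial projections and is the unit by
  \<open>proj_jointly_inj\<close>.\<close>

lemma sum_proj:
  assumes "v \<in> carrier E"
  shows "gfinprod E (\<lambda>x. \<phi> x (\<rho> x v)) I = v"
proof -
  define w where "w = gfinprod E (\<lambda>x. \<phi> x ((\<lambda>x\<in>I. \<rho> x v) x)) I"
  have w: "w \<in> carrier E"
    unfolding w_def by (rule sum_closed [OF proj_in_sum_group [OF assms]])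
  have "v \<otimes>\<^bsub>E\<^esub> inv\<^bsub>E\<^esub> w = \<one>\<^bsub>E\<^esub>"
  proof (rule proj_jointly_inj)
    fix x assume x: "x \<in> I"
    then interpret \<rho>: group_hom E "D x" "\<rho> x"
      by (intro group_hom.intro) (auto simp: group_hom_axioms_def proj_hom)
    have "\<rho> x w = \<rho> x v"
      unfolding w_def using proj_sum [OF x proj_in_sum_group [OF assms]] x by simp
    then show "\<rho> x (v \<otimes>\<^bsub>E\<^esub> inv\<^bsub>E\<^esub> w) = \<one>\<^bsub>D x\<^esub>"
      using assms w by simp
  qed (use assms w in simp)
  then have "w = v"
    using assms w by (metis E.inv_equality E.inv_inv E.inv_closed)
  moreover have "w = gfinprod E (\<lambda>x. \<phi> x (\<rho> x v)) I"
    unfolding w_def using assms by (intro E.gfinprod_cong) (auto simp: simp_implies_def)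
  ultimately show ?thesis by simp
qed

theorem sum_iso: "(\<lambda>h. gfinprod E (\<lambda>x. \<phi> x (h x)) I) \<in> iso (sum_group I D) E" (is "?\<Phi> \<in> _")
proof (rule isoI)
  show "?\<Phi> \<in> hom (sum_group I D) E"
    by (rule E.hom_group_sum) (auto simp: incl_hom)
  show "bij_betw ?\<Phi> (carrier (sum_group I D)) (carrier E)"
  \<comment> \<open>The inverse lists the components. They are restricted to \<open>I\<close>
    because the elements of \<open>sum_group\<close> are extensional functions.\<close>
  proof (rule bij_betw_byWitness [where f' = "\<lambda>v. \<lambda>x\<in>I. \<rho> x v"])
    show "\<forall>h\<in>carrier (sum_group I D). (\<lambda>x\<in>I. \<rho> x (?\<Phi> h)) = h"
    proof
      fix h assume h: "h \<in> carrier (sum_group I D)"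
      then have "h \<in> extensional I" by (simp add: carrier_sum_group PiE_def)
      then show "(\<lambda>x\<in>I. \<rho> x (?\<Phi> h)) = h"
        using h by (auto simp: fun_eq_iff proj_sum extensional_def)
    qed
    show "\<forall>v\<in>carrier E. ?\<Phi> (\<lambda>x\<in>I. \<rho> x v) = v"
    proof
      fix v assume v: "v \<in> carrier E"
      have "?\<Phi> (\<lambda>x\<in>I. \<rho> x v) = gfinprod E (\<lambda>x. \<phi> x (\<rho> x v)) I"
        using v by (intro E.gfinprod_cong) (auto simp: simp_implies_def)
      then show "?\<Phi> (\<lambda>x\<in>I. \<rho> x v) = v"
        using v by (simp add: sum_proj)
    qed
  qed (auto intro: sum_closed proj_in_sum_group)
qed

end

text \<open>The record \<open>subgroup_generated G K Mod B\<close> is the image of \<open>K\<close> in \<open>G Mod B\<close>, even when \<open>B\<close> is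
  not contained in \<open>K\<close>. Hence homology is a group without appeal to \<open>d \<circ> d = 0\<close>.\<close>

lemma subgroup_generated_Mod_eq:
  assumes "comm_group G" "subgroup K G" "subgroup B G"
  shows "subgroup_generated G K Mod B = subgroup_generated (G Mod B) ((\<lambda>u. B #>\<^bsub>G\<^esub> u) ` K)"
proof -
  interpret G: comm_group G by fact
  interpret K: subgroup K G by fact
  interpret B: normal B G using assms by (simp add: G.normal_iff_subgroup)
  interpret Q: group_hom G "G Mod B" "\<lambda>u. B #>\<^bsub>G\<^esub> u"
    using B.r_coset_hom_Mod B.factorgroup_is_group
    by (intro group_hom.intro) (simp_all add: group_hom_axioms_def G.is_group)
  have "carrier (subgroup_generated (G Mod B) ((\<lambda>u. B #>\<^bsub>G\<^esub> u) ` K)) = (\<lambda>u. B #>\<^bsub>G\<^esub> u) ` K"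
    using Q.subgroup_img_is_subgroup [OF assms(2)] by (rule subgroup.carrier_subgroup_generated_subgroup)
  moreover have "carrier (subgroup_generated G K Mod B) = (\<lambda>u. B #>\<^bsub>G\<^esub> u) ` K"
    by (simp add: carrier_FactGroup r_coset_def)
  moreover have "set_mult (subgroup_generated G K) = set_mult G"
    by (intro ext) (simp add: set_mult_def)
  ultimately show ?thesis
    by (intro monoid.equality) simp_all
qed

lemma
  assumes "comm_group G" "subgroup K G" "subgroup B G"
  shows comm_group_subquotient: "comm_group (subgroup_generated G K Mod B)"
    and carrier_subquotient: "carrier (subgroup_generated G K Mod B) = (\<lambda>u. B #>\<^bsub>G\<^esub> u) ` K"
proof -
  interpret G: comm_group G by fact
  interpret K: subgroup K G by fact
  interpret B: normal B G using assms by (simp add: G.normal_iff_subgroup)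
  show "comm_group (subgroup_generated G K Mod B)"
    unfolding subgroup_generated_Mod_eq [OF assms]
    using B.factorgroup_is_group G.abelian_FactGroup [OF assms(3)]
    by (rule group.abelian_subgroup_generated)
  show "carrier (subgroup_generated G K Mod B) = (\<lambda>u. B #>\<^bsub>G\<^esub> u) ` K"
    by (simp add: carrier_FactGroup r_coset_def)
qed

section \<open>Maps induced on cosets\<close>

lemma (in group) r_coset_eq_self_iff:
  assumes "subgroup B G" "u \<in> carrier G"
  shows "B #> u = B \<longleftrightarrow> u \<in> B"
  using coset_join1 coset_join2 assms by (metis subgroup.subset)

text \<open>The union defining \<open>coset_map\<close> runs over all representatives. Two of them
  differ by an element of \<open>B\<close>, which \<open>h\<close> sends into \<open>B'\<close>, so
  each contributes the same coset.\<close>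

lemma coset_map_r_coset:
  assumes "group G" "group G'" "h \<in> hom G G'" "subgroup B G" "subgroup B' G'" "h ` B \<subseteq> B'"
    and u: "u \<in> carrier G"
  shows "coset_map G' B' h (B #>\<^bsub>G\<^esub> u) = B' #>\<^bsub>G'\<^esub> h u"
proof -
  interpret G: group G by fact
  interpret G': group G' by fact
  interpret h: group_hom G G' h using assms by unfold_locales
  have "B' #>\<^bsub>G'\<^esub> h w = B' #>\<^bsub>G'\<^esub> h u" if "w \<in> B #>\<^bsub>G\<^esub> u" for w
  proof -
    obtain b where b: "b \<in> B" "w = b \<otimes>\<^bsub>G\<^esub> u" using \<open>w \<in> _\<close> by (auto simp: r_coset_def)
    then have bc: "b \<in> carrier G" using assms(4) by (auto dest: subgroup.mem_carrier)
    then have "h w = h b \<otimes>\<^bsub>G'\<^esub> h u" using b u by simp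
    moreover have "h b \<in> B'" using b assms(6) by auto
    ultimately have "h w \<in> B' #>\<^bsub>G'\<^esub> h u" by (auto simp: r_coset_def)
    then show ?thesis
      using G'.repr_independence [OF _ _ assms(5)] u by simp
  qed
  moreover have "u \<in> B #>\<^bsub>G\<^esub> u" using assms u G.rcos_self by blast
  ultimately show ?thesis unfolding coset_map_def by blast
qed

text \<open>With \<open>K\<close> the whole group this yields the maps on relative chains; with
  \<open>K\<close> the cycles and \<open>B\<close> the boundaries it yields the maps on
  homology.\<close>

lemma coset_map_hom:
  assumes "comm_group G" "comm_group G'" "h \<in> hom G G'"
    and "subgroup K G" "subgroup K' G'" "h ` K \<subseteq> K'"
    and "subgroup B G" "subgroup B' G'" "h ` B \<subseteq> B'"
  shows "coset_map G' B' h \<in> hom (subgroup_generated G K Mod B) (subgroup_generated G' K' Mod B')"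
proof -
  interpret G: comm_group G by fact
  interpret G': comm_group G' by fact
  interpret B: normal B G using assms by (simp add: G.normal_iff_subgroup)
  interpret B': normal B' G' using assms by (simp add: G'.normal_iff_subgroup)
  have K: "K \<subseteq> carrier G" using assms subgroup.subset by blast
  have map: "coset_map G' B' h (B #>\<^bsub>G\<^esub> u) = B' #>\<^bsub>G'\<^esub> h u" if "u \<in> carrier G" for u
    using that assms by (intro coset_map_r_coset) (auto simp: comm_group_def)
  show ?thesis
  proof (rule homI)
    fix U assume "U \<in> carrier (subgroup_generated G K Mod B)"
    then obtain u where u: "u \<in> K" "U = B #>\<^bsub>G\<^esub> u"
      unfolding carrier_subquotient [OF assms(1,4,7)] by blast
    then have "h u \<in> K'" "coset_map G' B' h U = B' #>\<^bsub>G'\<^esub> h u"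
      using assms(6) K map by blast+
    then show "coset_map G' B' h U \<in> carrier (subgroup_generated G' K' Mod B')"
      unfolding carrier_subquotient [OF assms(2,5,8)] by blast
  next
    fix U V assume "U \<in> carrier (subgroup_generated G K Mod B)" "V \<in> carrier (subgroup_generated G K Mod B)"
    then obtain u v where uv: "U = B #>\<^bsub>G\<^esub> u" "V = B #>\<^bsub>G\<^esub> v" "u \<in> carrier G" "v \<in> carrier G"
      using K unfolding carrier_subquotient [OF assms(1,4,7)] by blast
    moreover have "h u \<in> carrier G'" "h v \<in> carrier G'"
      using uv assms by (auto intro: hom_in_carrier)
    moreover have "U \<otimes>\<^bsub>subgroup_generated G K Mod B\<^esub> V = B #>\<^bsub>G\<^esub> (u \<otimes>\<^bsub>G\<^esub> v)"
      using uv B.rcos_sum by (simp add: set_mult_def)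
    moreover have "(B' #>\<^bsub>G'\<^esub> h u) \<otimes>\<^bsub>subgroup_generated G' K' Mod B'\<^esub> (B' #>\<^bsub>G'\<^esub> h v) = B' #>\<^bsub>G'\<^esub> (h u \<otimes>\<^bsub>G'\<^esub> h v)"
      using calculation B'.rcos_sum by (simp add: set_mult_def)
    ultimately show "coset_map G' B' h (U \<otimes>\<^bsub>subgroup_generated G K Mod B\<^esub> V) =
        coset_map G' B' h U \<otimes>\<^bsub>subgroup_generated G' K' Mod B'\<^esub> coset_map G' B' h V"
      using map hom_mult [OF assms(3)] by simp
  qed
qed

section \<open>Passage of direct sums to subquotients and homology\<close>

text \<open>The conditions \<open>other\<close>, \<open>finite\<close> and \<open>inj\<close> are
  imposed only modulo the subgroups divided out. For chains this slack matters: a chain of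
  \<open>C_x\<close> restricted to \<open>C_y\<close> can survive on chains lying in both stars, but
  these avoid \<open>y\<close>, so the result is a chain of the punctured star of
  \<open>y\<close>.\<close>

lemma direct_sum_decomposition_subquotient:
  assumes E: "comm_group E" "subgroup K E" "subgroup B E"
    and D: "\<And>x. x \<in> I \<Longrightarrow> comm_group (D x)" "\<And>x. x \<in> I \<Longrightarrow> subgroup (L x) (D x)"
      "\<And>x. x \<in> I \<Longrightarrow> subgroup (C x) (D x)"
    and \<phi>: "\<And>x. x \<in> I \<Longrightarrow> \<phi> x \<in> hom (D x) E" "\<And>x. x \<in> I \<Longrightarrow> \<phi> x ` L x \<subseteq> K"
      "\<And>x. x \<in> I \<Longrightarrow> \<phi> x ` C x \<subseteq> B"
    and \<rho>: "\<And>x. x \<in> I \<Longrightarrow> \<rho> x \<in> hom E (D x)" "\<And>x. x \<in> I \<Longrightarrow> \<rho> x ` K \<subseteq> L x"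
      "\<And>x. x \<in> I \<Longrightarrow> \<rho> x ` B \<subseteq> C x"
    and id: "\<And>x u. x \<in> I \<Longrightarrow> u \<in> L x \<Longrightarrow> \<rho> x (\<phi> x u) = u"
    and other: "\<And>x y u. x \<in> I \<Longrightarrow> y \<in> I \<Longrightarrow> x \<noteq> y \<Longrightarrow> u \<in> L x \<Longrightarrow> \<rho> y (\<phi> x u) \<in> C y"
    and finite: "\<And>v. v \<in> K \<Longrightarrow> finite {x \<in> I. \<rho> x v \<notin> C x}"
    and inj: "\<And>v. v \<in> K \<Longrightarrow> (\<And>x. x \<in> I \<Longrightarrow> \<rho> x v \<in> C x) \<Longrightarrow> v \<in> B"
  shows "direct_sum_decomposition I (\<lambda>x. subgroup_generated (D x) (L x) Mod C x)
           (subgroup_generated E K Mod B) (\<lambda>x. coset_map E B (\<phi> x)) (\<lambda>x. coset_map (D x) (C x) (\<rho> x))"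
proof -
  interpret E: comm_group E by fact
  have DG: "group (D x)" if "x \<in> I" for x using D that by (simp add: comm_group_def)
  have \<phi>_map: "coset_map E B (\<phi> x) (C x #>\<^bsub>D x\<^esub> u) = B #>\<^bsub>E\<^esub> \<phi> x u" if "x \<in> I" "u \<in> L x" for x u
    using that D E \<phi> DG by (intro coset_map_r_coset) (auto simp: E.is_group dest: subgroup.mem_carrier)
  have \<rho>_map: "coset_map (D x) (C x) (\<rho> x) (B #>\<^bsub>E\<^esub> v) = C x #>\<^bsub>D x\<^esub> \<rho> x v" if "x \<in> I" "v \<in> K" for x v
    using that D E \<rho> DG by (intro coset_map_r_coset) (auto simp: E.is_group dest: subgroup.mem_carrier)
  \<comment> \<open>The unit of the quotient is the coset \<open>C x\<close> itself, so triviality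
    of a class becomes membership in \<open>C x\<close>, the form in which the hypotheses are
    given.\<close>
  have one: "C x #>\<^bsub>D x\<^esub> u = C x \<longleftrightarrow> u \<in> C x" if "x \<in> I" "u \<in> L x" for x u
    using that D DG by (intro group.r_coset_eq_self_iff) (auto dest: subgroup.mem_carrier)
  show ?thesis
  proof (rule direct_sum_decomposition.intro)
    fix v assume "v \<in> carrier (subgroup_generated E K Mod B)"
    then obtain w where w: "w \<in> K" "v = B #>\<^bsub>E\<^esub> w" using E by (auto simp: carrier_subquotient)
    have wL: "\<rho> x w \<in> L x" if "x \<in> I" for x using \<rho>(2) that w(1) by blast
    show "finite {x \<in> I. coset_map (D x) (C x) (\<rho> x) v \<noteq> \<one>\<^bsub>subgroup_generated (D x) (L x) Mod C x\<^esub>}"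
      using finite [OF w(1)] w wL by (simp add: \<rho>_map one cong: conj_cong)
    show "v = \<one>\<^bsub>subgroup_generated E K Mod B\<^esub>"
      if "\<And>x. x \<in> I \<Longrightarrow> coset_map (D x) (C x) (\<rho> x) v = \<one>\<^bsub>subgroup_generated (D x) (L x) Mod C x\<^esub>"
    proof -
      have "w \<in> B" using that w wL by (intro inj) (auto simp: \<rho>_map one)
      then show ?thesis using w E by (simp add: E.coset_join2 subgroup.mem_carrier)
    qed
  next
    fix x u assume x: "x \<in> I" and "u \<in> carrier (subgroup_generated (D x) (L x) Mod C x)"
    then obtain w where w: "w \<in> L x" "u = C x #>\<^bsub>D x\<^esub> w" using D by (auto simp: carrier_subquotient)
    have wK: "\<phi> x w \<in> K" using \<phi>(2) x w(1) by blast
    show "coset_map (D x) (C x) (\<rho> x) (coset_map E B (\<phi> x) u) = u"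
      using x w wK by (simp add: \<phi>_map \<rho>_map id)
    show "coset_map (D y) (C y) (\<rho> y) (coset_map E B (\<phi> x) u) = \<one>\<^bsub>subgroup_generated (D y) (L y) Mod C y\<^esub>"
      if "y \<in> I" "x \<noteq> y" for y
    proof -
      have "\<rho> y (\<phi> x w) \<in> L y" using \<rho>(2) that wK by blast
      then show ?thesis using x w wK that by (simp add: \<phi>_map \<rho>_map one other)
    qed
  next
    show "comm_group (subgroup_generated E K Mod B)"
      using E by (rule comm_group_subquotient)
  next
    fix x assume x: "x \<in> I"
    show "comm_group (subgroup_generated (D x) (L x) Mod C x)"
      using D x by (intro comm_group_subquotient)
    show "coset_map E B (\<phi> x) \<in> hom (subgroup_generated (D x) (L x) Mod C x) (subgroup_generated E K Mod B)"
      using E D \<phi> x by (intro coset_map_hom)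
    show "coset_map (D x) (C x) (\<rho> x) \<in> hom (subgroup_generated E K Mod B) (subgroup_generated (D x) (L x) Mod C x)"
      using E D \<rho> x by (intro coset_map_hom)
  qed
qed

text \<open>Only the inclusions are assumed to be chain maps; this is enough, because the
  projections are determined by the inclusions.\<close>

lemma direct_sum_decomposition_homology:
  fixes D :: "'i \<Rightarrow> int \<Rightarrow> 'c monoid" and E :: "int \<Rightarrow> 'd monoid"
  assumes dec: "\<And>k. direct_sum_decomposition I (\<lambda>x. D x k) (E k) (\<lambda>x. \<phi> x k) (\<lambda>x. \<rho> x k)"
    and d: "\<And>x k. x \<in> I \<Longrightarrow> d x k \<in> hom (D x k) (D x (k - 1))"
    and e: "\<And>k. e k \<in> hom (E k) (E (k - 1))"
    and chain_map: "\<And>x k u. x \<in> I \<Longrightarrow> u \<in> carrier (D x k) \<Longrightarrow> e k (\<phi> x k u) = \<phi> x (k - 1) (d x k u)"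
  shows "direct_sum_decomposition I (\<lambda>x. homology (D x) (d x) n) (homology E e n)
           (\<lambda>x. coset_map (E n) (boundaries E e n) (\<phi> x n))
           (\<lambda>x. coset_map (D x n) (boundaries (D x) (d x) n) (\<rho> x n))"
proof -
  interpret dec: direct_sum_decomposition I "\<lambda>x. D x k" "E k" "\<lambda>x. \<phi> x k" "\<lambda>x. \<rho> x k" for k
    by (rule dec)
  have dh: "group_hom (D x k) (D x (k - 1)) (d x k)" if "x \<in> I" for x k
    using d that by (intro group_hom.intro) (auto simp: group_hom_axioms_def)
  interpret e: group_hom "E k" "E (k - 1)" "e k" for k
    using e by unfold_locales
  have d_closed: "d x k u \<in> carrier (D x (k - 1))" if "x \<in> I" "u \<in> carrier (D x k)" for x k u
    using that d by (auto intro: hom_in_carrier)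
  \<comment> \<open>Write \<open>v\<close> as the sum of the
    \<open>\<phi> y k (\<rho> y k v)\<close> and apply \<open>e k\<close>. By
    \<open>chain_map\<close> the result is the sum of the images of the
    \<open>d y k (\<rho> y k v)\<close>, collected in \<open>h\<close>, and projecting to
    \<open>x\<close> picks out the term at \<open>x\<close>.\<close>
  have proj_chain_map: "\<rho> x (k - 1) (e k v) = d x k (\<rho> x k v)"
    if x: "x \<in> I" and v: "v \<in> carrier (E k)" for x k v
  proof -
    define h where "h = (\<lambda>y\<in>I. d y k (\<rho> y k v))"
    have fin: "finite {y \<in> I. \<rho> y k v \<noteq> \<one>\<^bsub>D y k\<^esub>}"
      using v by (rule dec.finite_proj)
    have "finite {y \<in> I. d y k (\<rho> y k v) \<noteq> \<one>\<^bsub>D y (k - 1)\<^esub>}"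
      by (rule finite_subset [OF _ fin]) (auto simp: group_hom.hom_one [OF dh])
    then have h: "h \<in> carrier (sum_group I (\<lambda>y. D y (k - 1)))"
      using v by (auto simp: carrier_sum_group h_def d_closed conj_commute cong: rev_conj_cong)
    have "finite {y \<in> I. \<phi> y k (\<rho> y k v) \<noteq> \<one>\<^bsub>E k\<^esub>}"
      by (rule finite_subset [OF _ fin]) (auto simp: hom_one [OF dec.incl_hom])
    then have "e k (gfinprod (E k) (\<lambda>y. \<phi> y k (\<rho> y k v)) I)
        = gfinprod (E (k - 1)) (\<lambda>y. e k (\<phi> y k (\<rho> y k v))) I"
      using v e by (intro dec.E.hom_gfinprod dec.comm_group_sum) auto
    also have "\<dots> = gfinprod (E (k - 1)) (\<lambda>y. \<phi> y (k - 1) (h y)) I"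
      using v by (intro dec.E.gfinprod_cong) (auto simp: chain_map h_def d_closed simp_implies_def)
    finally have "e k v = gfinprod (E (k - 1)) (\<lambda>y. \<phi> y (k - 1) (h y)) I"
      using v by (simp add: dec.sum_proj)
    then show ?thesis
      using dec.proj_sum [OF x h] x by (simp add: h_def)
  qed
  have cyc: "subgroup (cycles E e n) (E n)" "x \<in> I \<Longrightarrow> subgroup (cycles (D x) (d x) n) (D x n)" for x
    unfolding cycles_def using e.subgroup_kernel group_hom.subgroup_kernel [OF dh] by auto
  have bd: "subgroup (boundaries E e n) (E n)" "x \<in> I \<Longrightarrow> subgroup (boundaries (D x) (d x) n) (D x n)" for x
    unfolding boundaries_def using e.img_is_subgroup [of "n + 1"] group_hom.img_is_subgroup [OF dh, of x "n + 1"]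
    by auto
  have \<phi>_bd: "\<phi> x n ` boundaries (D x) (d x) n \<subseteq> boundaries E e n" if "x \<in> I" for x
  proof -
    have "\<phi> x n (d x (n + 1) u) = e (n + 1) (\<phi> x (n + 1) u)" if "u \<in> carrier (D x (n + 1))" for u
      using chain_map [OF \<open>x \<in> I\<close> that] by simp
    then show ?thesis
      using that by (auto simp: boundaries_def)
  qed
  have \<rho>_bd: "\<rho> x n ` boundaries E e n \<subseteq> boundaries (D x) (d x) n" if "x \<in> I" for x
  proof -
    have "\<rho> x n (e (n + 1) v) = d x (n + 1) (\<rho> x (n + 1) v)" if "v \<in> carrier (E (n + 1))" for v
      using proj_chain_map [OF \<open>x \<in> I\<close> that] by simp
    then show ?thesis
      using that by (auto simp: boundaries_def)
  qed
  have cyc_sub: "cycles E e n \<subseteq> carrier (E n)" "cycles (D x) (d x) n \<subseteq> carrier (D x n)" for x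
    by (auto simp: cycles_def kernel_def)
  show ?thesis
    unfolding homology_def
  proof (rule direct_sum_decomposition_subquotient)
    show "\<phi> x n ` cycles (D x) (d x) n \<subseteq> cycles E e n" if "x \<in> I" for x
      unfolding cycles_def kernel_def using that
      by (auto simp: chain_map hom_one [OF dec.incl_hom])
    show "\<rho> x n ` cycles E e n \<subseteq> cycles (D x) (d x) n" if "x \<in> I" for x
      unfolding cycles_def kernel_def using that
      by (auto simp flip: proj_chain_map simp: hom_one [OF dec.proj_hom])
    show "\<rho> x n (\<phi> x n u) = u" if "x \<in> I" "u \<in> cycles (D x) (d x) n" for x u
      using that subsetD [OF cyc_sub(2)] by (simp add: dec.proj_incl)
    show "\<rho> y n (\<phi> x n u) \<in> boundaries (D y) (d y) n"
      if "x \<in> I" "y \<in> I" "x \<noteq> y" "u \<in> cycles (D x) (d x) n" for x y u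
    proof -
      have "\<rho> y n (\<phi> x n u) = \<one>\<^bsub>D y n\<^esub>" using that subsetD [OF cyc_sub(2)] by (simp add: dec.proj_incl_other)
      then show ?thesis using that bd by (simp add: subgroup.one_closed)
    qed
    fix v assume "v \<in> cycles E e n"
    then have v: "v \<in> carrier (E n)" using cyc_sub by blast
    show "finite {x \<in> I. \<rho> x n v \<notin> boundaries (D x) (d x) n}"
      by (rule finite_subset [OF _ dec.finite_proj [OF v]]) (auto simp: subgroup.one_closed [OF bd(2)])
    assume "\<And>x. x \<in> I \<Longrightarrow> \<rho> x n v \<in> boundaries (D x) (d x) n"
    \<comment> \<open>Joint injectivity on homology: each component of \<open>v\<close> is a
      boundary, hence so is its image under the inclusion, and \<open>v\<close> is the sum of these
      images.\<close>
    then have "gfinprod (E n) (\<lambda>x. \<phi> x n (\<rho> x n v)) I \<in> boundaries E e n"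
      using \<phi>_bd bd by (intro dec.E.gfinprod_in_submonoid) (auto intro: subgroup.subgroup_is_submonoid)
    then show "v \<in> boundaries E e n"
      using v by (simp add: dec.sum_proj)
  qed (use cyc bd \<phi>_bd \<rho>_bd dec.incl_hom dec.proj_hom dec.comm_group_summand dec.comm_group_sum in auto)
qed

subsection \<open>Chains\<close>

lemma ab_functor_subset: "ab_functor X F f \<Longrightarrow> Y \<subseteq> X \<Longrightarrow> ab_functor Y F f"
  unfolding ab_functor_def by (meson subsetD)

lemma nchains_mono: "Y \<subseteq> X \<Longrightarrow> nchains Y n \<subseteq> nchains X n"
  by (auto simp: nchains_def)

lemma nchains_subset_iff: "\<sigma> \<in> nchains X n \<Longrightarrow> \<sigma> \<in> nchains Y n \<longleftrightarrow> \<sigma> \<subseteq> Y"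
  by (auto simp: nchains_def)

lemma nchains_total:
  assumes "\<sigma> \<in> nchains X n" "x \<in> \<sigma>" "y \<in> \<sigma>"
  shows "x \<le> y \<or> y \<le> x"
  using assms by (auto simp: nchains_def Complete_Partial_Order.chain_def)

lemma chain_min_eqI: "x \<in> \<sigma> \<Longrightarrow> (\<And>y. y \<in> \<sigma> \<Longrightarrow> x \<le> y) \<Longrightarrow> chain_min \<sigma> = x"
  unfolding chain_min_def by (rule Least_equality)

text \<open>A finite nonempty set has a minimal element; in a chain it is comparable with all others
  and therefore least, so the \<open>LEAST\<close> in \<open>chain_min\<close> is attained although
  the order of the type is only partial.\<close>

lemma
  assumes "\<sigma> \<in> nchains X n"
  shows chain_min_in: "chain_min \<sigma> \<in> \<sigma>"
    and chain_min_le: "y \<in> \<sigma> \<Longrightarrow> chain_min \<sigma> \<le> y"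
proof -
  have "finite \<sigma>" "\<sigma> \<noteq> {}"
    using assms by (auto simp: nchains_def)
  then obtain m where m: "m \<in> \<sigma>" "\<And>y. y \<in> \<sigma> \<Longrightarrow> \<not> y < m"
    using finite_has_minimal [of \<sigma>] by (metis less_le)
  then have "m \<le> y" if "y \<in> \<sigma>" for y
    using nchains_total [OF assms m(1) that] m(2) [OF that] by (auto simp: less_le)
  then have "chain_min \<sigma> = m" "\<And>y. y \<in> \<sigma> \<Longrightarrow> m \<le> y"
    using m by (auto intro: chain_min_eqI)
  then show "chain_min \<sigma> \<in> \<sigma>" "y \<in> \<sigma> \<Longrightarrow> chain_min \<sigma> \<le> y"
    using m by auto
qed

lemma nchains_subset: "\<sigma> \<in> nchains X n \<Longrightarrow> \<sigma> \<subseteq> X"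
  by (simp add: nchains_def)

lemma chain_min_in_poset: "\<sigma> \<in> nchains X n \<Longrightarrow> chain_min \<sigma> \<in> X"
  using nchains_subset chain_min_in by blast

subsection \<open>Faces\<close>

text \<open>Counting predecessors is strictly increasing along the chain, hence injective, and takes
  values below the cardinality, so it is onto by counting. This makes the description that defines
  \<open>vertex\<close> unique.\<close>

lemma vertex_bij:
  assumes "\<sigma> \<in> nchains X n"
  shows "bij_betw (\<lambda>x. card {y \<in> \<sigma>. y < x}) \<sigma> {..<card \<sigma>}"
proof -
  have fin: "finite \<sigma>"
    using assms by (simp add: nchains_def)
  have mono: "card {y \<in> \<sigma>. y < x} < card {y \<in> \<sigma>. y < z}" if "x \<in> \<sigma>" "x < z" for x z
    using that fin by (intro psubset_card_mono) (auto intro: order.strict_trans)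
  have "inj_on (\<lambda>x. card {y \<in> \<sigma>. y < x}) \<sigma>"
  proof (rule inj_onI)
    fix x z assume "x \<in> \<sigma>" "z \<in> \<sigma>" and eq: "card {y \<in> \<sigma>. y < x} = card {y \<in> \<sigma>. y < z}"
    then have "\<not> x < z" "\<not> z < x" "x \<le> z \<or> z \<le> x"
      using mono [of x z] mono [of z x] nchains_total [OF assms] by auto
    then show "x = z"
      by (auto simp: less_le)
  qed
  moreover have "(\<lambda>x. card {y \<in> \<sigma>. y < x}) ` \<sigma> \<subseteq> {..<card \<sigma>}"
    using fin by (auto intro!: psubset_card_mono)
  ultimately show ?thesis
    by (simp add: bij_betw_def card_image card_subset_eq)
qed

lemma
  assumes "\<sigma> \<in> nchains X n" "i \<le> nat n"
  shows vertex_in: "vertex \<sigma> i \<in> \<sigma>"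
    and card_below_vertex: "card {y \<in> \<sigma>. y < vertex \<sigma> i} = i"
proof -
  \<comment> \<open>Nonemptiness forces \<open>n \<ge> 0\<close>, so that \<open>nat n\<close> does
    not truncate and \<open>card \<sigma>\<close> equals \<open>nat n + 1\<close>.\<close>
  have "int (card \<sigma>) = n + 1" "card \<sigma> > 0"
    using assms(1) by (auto simp: nchains_def card_gt_0_iff)
  then have "i < card \<sigma>"
    using assms(2) by linarith
  then have "\<exists>!x. x \<in> \<sigma> \<and> card {y \<in> \<sigma>. y < x} = i"
    using vertex_bij [OF assms(1)] unfolding bij_betw_iff_bijections by (metis lessThan_iff)
  then have "vertex \<sigma> i \<in> \<sigma> \<and> card {y \<in> \<sigma>. y < vertex \<sigma> i} = i"
    unfolding vertex_def by (rule theI')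
  then show "vertex \<sigma> i \<in> \<sigma>" "card {y \<in> \<sigma>. y < vertex \<sigma> i} = i"
    by auto
qed

lemma face_in_nchains:
  assumes "\<sigma> \<in> nchains X n" "n \<ge> 1" "i \<le> nat n"
  shows "\<sigma> - {vertex \<sigma> i} \<in> nchains X (n - 1)"
proof -
  have v: "vertex \<sigma> i \<in> \<sigma>"
    using assms by (blast intro: vertex_in)
  have \<sigma>: "\<sigma> \<subseteq> X" "finite \<sigma>" "Complete_Partial_Order.chain (\<le>) \<sigma>" "int (card \<sigma>) = n + 1"
    using assms by (auto simp: nchains_def)
  have card: "int (card (\<sigma> - {vertex \<sigma> i})) = n"
    using \<sigma> v assms(2) by (simp add: card_Diff_singleton of_nat_diff)
  \<comment> \<open>Here \<open>n \<ge> 1\<close> is essential: removing the only vertex of a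
    0-chain leaves the empty set, which \<open>nchains\<close> excludes.\<close>
  then have "\<sigma> - {vertex \<sigma> i} \<noteq> {}"
    using assms(2) by (metis card.empty of_nat_0 not_one_le_zero)
  then show ?thesis
    using \<sigma> card by (auto simp: nchains_def intro: chain_subset)
qed

lemma vertex_0:
  assumes "\<sigma> \<in> nchains X n"
  shows "vertex \<sigma> 0 = chain_min \<sigma>"
proof -
  have "finite \<sigma>"
    using assms by (simp add: nchains_def)
  moreover have v: "vertex \<sigma> 0 \<in> \<sigma>" "card {y \<in> \<sigma>. y < vertex \<sigma> 0} = 0"
    using vertex_in [OF assms] card_below_vertex [OF assms] by simp_all
  ultimately have "\<not> chain_min \<sigma> < vertex \<sigma> 0"
    using chain_min_in [OF assms] by auto
  then show ?thesis
    using chain_min_le [OF assms v(1)] by (auto simp: less_le)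
qed

lemma vertex_inj:
  assumes "\<sigma> \<in> nchains X n" "i \<le> nat n" "j \<le> nat n" "vertex \<sigma> i = vertex \<sigma> j"
  shows "i = j"
  using card_below_vertex assms by metis

lemma chain_min_face:
  assumes "\<sigma> \<in> nchains X n" "1 \<le> i" "i \<le> nat n"
  shows "chain_min (\<sigma> - {vertex \<sigma> i}) = chain_min \<sigma>"
proof (rule chain_min_eqI)
  have "vertex \<sigma> i \<noteq> vertex \<sigma> 0"
    using vertex_inj [OF assms(1,3), of 0] assms(2) by auto
  then show "chain_min \<sigma> \<in> \<sigma> - {vertex \<sigma> i}"
    using chain_min_in [OF assms(1)] vertex_0 [OF assms(1)] by auto
qed (use chain_min_le [OF assms(1)] in auto)

text \<open>Exactly one element of the chain lies below \<open>vertex \<sigma> 1\<close>, and it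
  must be \<open>vertex \<sigma> 0\<close>. With that removed, totality places
  \<open>vertex \<sigma> 1\<close> below everything left.\<close>

lemma chain_min_face_0:
  assumes "\<sigma> \<in> nchains X n" "n \<ge> 1"
  shows "chain_min (\<sigma> - {vertex \<sigma> 0}) = vertex \<sigma> 1"
proof (rule chain_min_eqI)
  have n: "1 \<le> nat n" using assms(2) by simp
  have neq: "vertex \<sigma> 1 \<noteq> vertex \<sigma> 0"
    using vertex_inj [OF assms(1) n, of 0] by auto
  then show v1: "vertex \<sigma> 1 \<in> \<sigma> - {vertex \<sigma> 0}"
    using vertex_in [OF assms(1) n] by auto
  have "vertex \<sigma> 0 < vertex \<sigma> 1"
    using neq v1 chain_min_le [OF assms(1)] by (simp add: vertex_0 [OF assms(1)] less_le)
  then have v0: "vertex \<sigma> 0 \<in> {y \<in> \<sigma>. y < vertex \<sigma> 1}"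
    using vertex_in [OF assms(1)] by simp
  obtain z where z: "{y \<in> \<sigma>. y < vertex \<sigma> 1} = {z}"
    using card_below_vertex [OF assms(1) n] by (rule card_1_singletonE)
  have z_eq: "z = vertex \<sigma> 0"
    using v0 unfolding z by simp
  fix y assume y: "y \<in> \<sigma> - {vertex \<sigma> 0}"
  then have "y \<notin> {y \<in> \<sigma>. y < vertex \<sigma> 1}"
    unfolding z z_eq by simp
  then have "\<not> y < vertex \<sigma> 1"
    using y by simp
  then show "vertex \<sigma> 1 \<le> y"
    using nchains_total [OF assms(1), of y "vertex \<sigma> 1"] y v1 by (auto simp: less_le)
qed

subsection \<open>Chain groups\<close>

lemma comm_group_coeff:
  "ab_functor X F f \<Longrightarrow> \<sigma> \<in> nchains X n \<Longrightarrow> comm_group (F (chain_min \<sigma>))"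
  by (simp add: ab_functor_def chain_min_in_poset)

lemma group_coeff: "ab_functor X F f \<Longrightarrow> \<sigma> \<in> nchains X n \<Longrightarrow> group (F (chain_min \<sigma>))"
  by (rule comm_group.axioms(2) [OF comm_group_coeff])

lemma carrier_chain_group:
  assumes "ab_functor X F f"
  shows "carrier (chain_group X F n) =
    {c \<in> \<Pi>\<^sub>E \<sigma>\<in>nchains X n. carrier (F (chain_min \<sigma>)). finite {\<sigma> \<in> nchains X n. c \<sigma> \<noteq> \<one>\<^bsub>F (chain_min \<sigma>)\<^esub>}}"
  unfolding chain_group_def by (intro carrier_sum_group group_coeff [OF assms])

lemma chain_coeff_closed:
  "ab_functor X F f \<Longrightarrow> c \<in> carrier (chain_group X F n) \<Longrightarrow> \<sigma> \<in> nchains X n \<Longrightarrow>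
    c \<sigma> \<in> carrier (F (chain_min \<sigma>))"
  by (auto simp: carrier_chain_group)

lemma mult_chain_group:
  "a \<otimes>\<^bsub>chain_group X F n\<^esub> b = (\<lambda>\<sigma>\<in>nchains X n. a \<sigma> \<otimes>\<^bsub>F (chain_min \<sigma>)\<^esub> b \<sigma>)"
  by (simp add: chain_group_def)

lemma comm_group_chain_group:
  assumes "ab_functor X F f"
  shows "comm_group (chain_group X F n)"
proof (rule group.group_comm_groupI)
  show "group (chain_group X F n)"
    unfolding chain_group_def by (intro sum_group group_coeff [OF assms])
  fix a b assume "a \<in> carrier (chain_group X F n)" "b \<in> carrier (chain_group X F n)"
  then show "a \<otimes>\<^bsub>chain_group X F n\<^esub> b = b \<otimes>\<^bsub>chain_group X F n\<^esub> a"
    using comm_group_coeff [OF assms] assms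
    by (auto simp: mult_chain_group carrier_chain_group PiE_iff comm_groupE(4) intro!: restrict_ext)
qed

lemma group_chain_group: "ab_functor X F f \<Longrightarrow> group (chain_group X F n)"
  by (rule comm_group.axioms(2) [OF comm_group_chain_group])

section \<open>The differential\<close>

lemma simplex_hom:
  assumes "ab_functor X F f" "\<tau> \<in> nchains X n"
  shows "(\<lambda>g. simplex X F n g \<tau>) \<in> hom (F (chain_min \<tau>)) (chain_group X F n)"
proof (rule homI)
  note gr = group.is_monoid [OF group_coeff [OF assms(1)]]
  fix g assume g: "g \<in> carrier (F (chain_min \<tau>))"
  have "finite {\<sigma> \<in> nchains X n. simplex X F n g \<tau> \<sigma> \<noteq> \<one>\<^bsub>F (chain_min \<sigma>)\<^esub>}"
    by (rule finite_subset [of _ "{\<tau>}"]) (auto simp: simplex_def)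
  then show "simplex X F n g \<tau> \<in> carrier (chain_group X F n)"
    using g assms gr by (auto simp: carrier_chain_group simplex_def monoid.one_closed)
next
  note gr = group.is_monoid [OF group_coeff [OF assms(1)]]
  fix g h assume "g \<in> carrier (F (chain_min \<tau>))" "h \<in> carrier (F (chain_min \<tau>))"
  then show "simplex X F n (g \<otimes>\<^bsub>F (chain_min \<tau>)\<^esub> h) \<tau> =
      simplex X F n g \<tau> \<otimes>\<^bsub>chain_group X F n\<^esub> simplex X F n h \<tau>"
    by (auto simp: simplex_def mult_chain_group monoid.l_one monoid.one_closed gr intro!: restrict_ext)
qed

text \<open>The two cases differ because only the face opposite to the minimum changes the
  coefficient group: there the coefficient is transported along \<open>f\<close>, while every other
  face keeps the minimum and hence the coefficient.\<close>

lemma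
  assumes "ab_functor X F f" "\<sigma> \<in> nchains X n" "n \<ge> 1"
  shows first_face_hom: "(\<lambda>g. simplex X F (n - 1) (f (vertex \<sigma> 0) (vertex \<sigma> 1) g) (\<sigma> - {vertex \<sigma> 0}))
      \<in> hom (F (chain_min \<sigma>)) (chain_group X F (n - 1))" (is ?first)
    and face_hom: "1 \<le> i \<Longrightarrow> i \<le> nat n \<Longrightarrow> (\<lambda>g. simplex X F (n - 1) g (\<sigma> - {vertex \<sigma> i}))
      \<in> hom (F (chain_min \<sigma>)) (chain_group X F (n - 1))"
proof -
  have "vertex \<sigma> 0 \<in> \<sigma>" "vertex \<sigma> 1 \<in> \<sigma>"
    using assms by (simp_all add: vertex_in)
  then have v: "vertex \<sigma> 0 \<in> X" "vertex \<sigma> 1 \<in> X" "vertex \<sigma> 1 \<in> \<sigma>"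
    using nchains_subset [OF assms(2)] by auto
  have "vertex \<sigma> 0 \<le> vertex \<sigma> 1"
    using v chain_min_le [OF assms(2)] vertex_0 [OF assms(2)] by simp
  then have "f (vertex \<sigma> 0) (vertex \<sigma> 1) \<in> hom (F (vertex \<sigma> 0)) (F (vertex \<sigma> 1))"
    using v assms(1) by (simp add: ab_functor_def)
  then have f: "f (vertex \<sigma> 0) (vertex \<sigma> 1) \<in> hom (F (chain_min \<sigma>)) (F (chain_min (\<sigma> - {vertex \<sigma> 0})))"
    using vertex_0 [OF assms(2)] chain_min_face_0 [OF assms(2,3)] by simp
  show ?first
    using hom_compose [OF f simplex_hom [OF assms(1) face_in_nchains [OF assms(2,3)]]]
    by (simp add: comp_def)
  show "(\<lambda>g. simplex X F (n - 1) g (\<sigma> - {vertex \<sigma> i})) \<in> hom (F (chain_min \<sigma>)) (chain_group X F (n - 1))"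
    if "1 \<le> i" "i \<le> nat n"
    using simplex_hom [OF assms(1) face_in_nchains [OF assms(2,3) that(2)]] chain_min_face [OF assms(2) that]
    by simp
qed

lemma simplex_boundary_hom:
  assumes "ab_functor X F f" "\<sigma> \<in> nchains X n" "n \<ge> 1"
  shows "(\<lambda>g. simplex_boundary X F f n g \<sigma>) \<in> hom (F (chain_min \<sigma>)) (chain_group X F (n - 1))"
proof -
  interpret C: comm_group "chain_group X F (n - 1)"
    using assms(1) by (rule comm_group_chain_group)
  show ?thesis
    unfolding simplex_boundary_def
    using assms first_face_hom face_hom
    by (intro C.hom_group_mult C.hom_finprod_pointwise hom_compose [OF _ C.int_pow_hom, unfolded comp_def])
      auto
qed

lemma boundary_hom:
  assumes "ab_functor X F f"
  shows "boundary X F f n \<in> hom (chain_group X F n) (chain_group X F (n - 1))"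
proof -
  interpret C: comm_group "chain_group X F (n - 1)"
    using assms by (rule comm_group_chain_group)
  show ?thesis
  proof (cases "n \<ge> 1")
    case True
    have "(\<lambda>c. gfinprod (chain_group X F (n - 1)) (\<lambda>\<sigma>. simplex_boundary X F f n (c \<sigma>) \<sigma>) (nchains X n))
        \<in> hom (chain_group X F n) (chain_group X F (n - 1))"
      \<comment> \<open>Only the source is unfolded: it has to appear as a direct sum for its
        universal property \<open>hom_group_sum\<close>, while the target remains the group
        interpreted as \<open>C\<close>.\<close>
      unfolding chain_group_def [of X F n]
      using True assms by (intro C.hom_group_sum) (auto intro: simplex_boundary_hom group_coeff)
    then show ?thesis
      using True by (simp add: boundary_def [abs_def])
  next
    case False
    then show ?thesis
      by (auto simp: boundary_def hom_def)
  qed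
qed

section \<open>Inclusions as chain maps\<close>

lemma chain_incl_hom:
  assumes "ab_functor X F f" "Y \<subseteq> X"
  shows "chain_incl Y X F n \<in> hom (chain_group Y F n) (chain_group X F n)"
proof (rule homI)
  note Y = ab_functor_subset [OF assms]
  note gr = group.is_monoid [OF group_coeff [OF assms(1)]]
  fix c assume c: "c \<in> carrier (chain_group Y F n)"
  then have "finite {\<sigma> \<in> nchains Y n. c \<sigma> \<noteq> \<one>\<^bsub>F (chain_min \<sigma>)\<^esub>}"
    by (simp add: carrier_chain_group [OF Y])
  then have "finite {\<sigma> \<in> nchains X n. chain_incl Y X F n c \<sigma> \<noteq> \<one>\<^bsub>F (chain_min \<sigma>)\<^esub>}"
    by (rule rev_finite_subset) (auto simp: chain_incl_def)
  then show "chain_incl Y X F n c \<in> carrier (chain_group X F n)"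
    using c by (auto simp: carrier_chain_group [OF Y] carrier_chain_group [OF assms(1)] chain_incl_def gr monoid.one_closed)
next
  note gr = group.is_monoid [OF group_coeff [OF assms(1)]]
  fix c c' assume "c \<in> carrier (chain_group Y F n)" "c' \<in> carrier (chain_group Y F n)"
  then show "chain_incl Y X F n (c \<otimes>\<^bsub>chain_group Y F n\<^esub> c') =
      chain_incl Y X F n c \<otimes>\<^bsub>chain_group X F n\<^esub> chain_incl Y X F n c'"
    by (auto simp: chain_incl_def mult_chain_group gr monoid.l_one monoid.one_closed intro!: restrict_ext)
qed

lemma chain_incl_simplex:
  assumes "Y \<subseteq> X" "\<tau> \<in> nchains Y n"
  shows "chain_incl Y X F n (simplex Y F n g \<tau>) = simplex X F n g \<tau>"
  using assms by (auto simp: chain_incl_def simplex_def intro!: restrict_ext)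

text \<open>Vertices and minima depend on \<open>\<sigma>\<close> alone, not on the ambient poset,
  so the faces and their coefficients are the same in \<open>Y\<close> and in \<open>X\<close>. It
  remains to move the inclusion through the product and the powers.\<close>

lemma chain_incl_simplex_boundary:
  assumes "ab_functor X F f" "Y \<subseteq> X" "\<sigma> \<in> nchains Y n" "n \<ge> 1" "g \<in> carrier (F (chain_min \<sigma>))"
  shows "chain_incl Y X F (n - 1) (simplex_boundary Y F f n g \<sigma>) = simplex_boundary X F f n g \<sigma>"
proof -
  note Y = ab_functor_subset [OF assms(1,2)]
  interpret CY: comm_group "chain_group Y F (n - 1)"
    using Y by (rule comm_group_chain_group)
  interpret CX: comm_group "chain_group X F (n - 1)"
    using assms(1) by (rule comm_group_chain_group)
  interpret incl: group_hom "chain_group Y F (n - 1)" "chain_group X F (n - 1)" "chain_incl Y X F (n - 1)"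
    using chain_incl_hom [OF assms(1,2)] by unfold_locales
  have \<sigma>: "\<sigma> \<in> nchains X n"
    using assms(3) nchains_mono [OF assms(2)] by blast
  note closed = hom_in_carrier [OF face_hom [OF Y assms(3,4)] assms(5)]
    hom_in_carrier [OF first_face_hom [OF Y assms(3,4)] assms(5)]
  have "chain_incl Y X F (n - 1) (finprod (chain_group Y F (n - 1))
        (\<lambda>i. simplex Y F (n - 1) g (\<sigma> - {vertex \<sigma> i}) [^]\<^bsub>chain_group Y F (n - 1)\<^esub> ((- 1) ^ i :: int)) {1..nat n})
    = finprod (chain_group X F (n - 1)) (\<lambda>i. chain_incl Y X F (n - 1)
        (simplex Y F (n - 1) g (\<sigma> - {vertex \<sigma> i}) [^]\<^bsub>chain_group Y F (n - 1)\<^esub> ((- 1) ^ i :: int))) {1..nat n}"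
    using closed CX.comm_group_axioms incl.homh
    by (intro CY.hom_finprod) (auto intro!: CY.int_pow_closed)
  also have "\<dots> = finprod (chain_group X F (n - 1))
        (\<lambda>i. simplex X F (n - 1) g (\<sigma> - {vertex \<sigma> i}) [^]\<^bsub>chain_group X F (n - 1)\<^esub> ((- 1) ^ i :: int)) {1..nat n}"
  proof (rule CX.finprod_cong', goal_cases)
    case 2
    show ?case
      using hom_in_carrier [OF face_hom [OF assms(1) \<sigma> assms(4)] assms(5)] by (auto intro!: CX.int_pow_closed)
  next
    case (3 i)
    then have "\<sigma> - {vertex \<sigma> i} \<in> nchains Y (n - 1)"
      using assms by (intro face_in_nchains) auto
    then show ?case
      using 3 closed by (simp add: incl.hom_int_pow chain_incl_simplex [OF assms(2)])
  qed simp
  moreover have "chain_incl Y X F (n - 1) (simplex Y F (n - 1) (f (vertex \<sigma> 0) (vertex \<sigma> 1) g) (\<sigma> - {vertex \<sigma> 0}))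
      = simplex X F (n - 1) (f (vertex \<sigma> 0) (vertex \<sigma> 1) g) (\<sigma> - {vertex \<sigma> 0})"
    using assms by (intro chain_incl_simplex face_in_nchains) auto
  ultimately show ?thesis
    unfolding simplex_boundary_def using closed
    by (subst incl.hom_mult) (auto intro!: CY.finprod_closed CY.int_pow_closed)
qed

lemma chain_incl_boundary:
  assumes "ab_functor X F f" "Y \<subseteq> X" and c: "c \<in> carrier (chain_group Y F n)"
  shows "chain_incl Y X F (n - 1) (boundary Y F f n c) = boundary X F f n (chain_incl Y X F n c)"
proof -
  note Y = ab_functor_subset [OF assms(1,2)]
  interpret CY: comm_group "chain_group Y F (n - 1)"
    using Y by (rule comm_group_chain_group)
  interpret CX: comm_group "chain_group X F (n - 1)"
    using assms(1) by (rule comm_group_chain_group)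
  interpret incl: group_hom "chain_group Y F (n - 1)" "chain_group X F (n - 1)" "chain_incl Y X F (n - 1)"
    using chain_incl_hom [OF assms(1,2)] by unfold_locales
  show ?thesis
  proof (cases "n \<ge> 1")
    case True
    note cc = chain_coeff_closed [OF Y c]
    have fin: "finite {\<sigma> \<in> nchains Y n. c \<sigma> \<noteq> \<one>\<^bsub>F (chain_min \<sigma>)\<^esub>}"
      using c by (simp add: carrier_chain_group [OF Y])
    have "finite {\<sigma> \<in> nchains Y n. simplex_boundary Y F f n (c \<sigma>) \<sigma> \<noteq> \<one>\<^bsub>chain_group Y F (n - 1)\<^esub>}"
      by (rule finite_subset [OF _ fin])
        (auto simp: hom_one [OF simplex_boundary_hom [OF Y _ True] group_coeff [OF Y] CY.is_group])
    then have "chain_incl Y X F (n - 1) (boundary Y F f n c) =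
        gfinprod (chain_group X F (n - 1))
          (\<lambda>\<sigma>. chain_incl Y X F (n - 1) (simplex_boundary Y F f n (c \<sigma>) \<sigma>)) (nchains Y n)"
      using True CX.comm_group_axioms incl.homh
      by (simp add: boundary_def, intro CY.hom_gfinprod)
        (auto intro: hom_in_carrier [OF simplex_boundary_hom [OF Y _ True] cc])
    also have "\<dots> = gfinprod (chain_group X F (n - 1))
          (\<lambda>\<sigma>. simplex_boundary X F f n (chain_incl Y X F n c \<sigma>) \<sigma>) (nchains X n)"
    \<comment> \<open>Chains of \<open>X\<close> outside \<open>Y\<close> carry the unit after
      extension, so enlarging the index set from \<open>nchains Y n\<close> to
      \<open>nchains X n\<close> adds only trivial factors.\<close>
    proof (rule CX.gfinprod_mono_neutral_cong_left [OF nchains_mono [OF assms(2)]])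
      note hom = simplex_boundary_hom [OF assms(1) _ True]
      show "simplex_boundary X F f n (chain_incl Y X F n c \<sigma>) \<sigma> = \<one>\<^bsub>chain_group X F (n - 1)\<^esub>"
        if "\<sigma> \<in> nchains X n - nchains Y n" for \<sigma>
        using that hom_one [OF hom group_coeff [OF assms(1)] CX.is_group, of \<sigma>] by (auto simp: chain_incl_def)
      show "chain_incl Y X F (n - 1) (simplex_boundary Y F f n (c \<sigma>) \<sigma>) =
          simplex_boundary X F f n (chain_incl Y X F n c \<sigma>) \<sigma>" if "\<sigma> \<in> nchains Y n" for \<sigma>
      proof -
        have "chain_incl Y X F n c \<sigma> = c \<sigma>"
          using that nchains_mono [OF assms(2)] by (auto simp: chain_incl_def)
        then show ?thesis
          using that cc True by (simp add: chain_incl_simplex_boundary [OF assms(1,2)])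
      qed
      show "(\<lambda>\<sigma>. simplex_boundary X F f n (chain_incl Y X F n c \<sigma>) \<sigma>)
          \<in> nchains X n \<rightarrow> carrier (chain_group X F (n - 1))"
        using hom_in_carrier [OF chain_incl_hom [OF assms(1,2)] c]
        by (blast intro: hom_in_carrier [OF hom] chain_coeff_closed [OF assms(1)])
    qed
    finally show ?thesis
      using True by (simp add: boundary_def)
  qed (simp add: boundary_def)
qed

subsection \<open>Relative chains\<close>

lemma restrict_nchains_hom:
  assumes "ab_functor X F f" "Y \<subseteq> X"
  shows "(\<lambda>c. restrict c (nchains Y n)) \<in> hom (chain_group X F n) (chain_group Y F n)"
proof (rule homI)
  note Y = ab_functor_subset [OF assms] and mono = nchains_mono [OF assms(2), of n]
  fix c assume c: "c \<in> carrier (chain_group X F n)"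
  then have "finite {\<sigma> \<in> nchains X n. c \<sigma> \<noteq> \<one>\<^bsub>F (chain_min \<sigma>)\<^esub>}"
    by (simp add: carrier_chain_group [OF assms(1)])
  then have "finite {\<sigma> \<in> nchains Y n. restrict c (nchains Y n) \<sigma> \<noteq> \<one>\<^bsub>F (chain_min \<sigma>)\<^esub>}"
    by (rule rev_finite_subset) (use mono in auto)
  then show "restrict c (nchains Y n) \<in> carrier (chain_group Y F n)"
    using c mono by (auto simp: carrier_chain_group [OF Y] carrier_chain_group [OF assms(1)] PiE_iff)
next
  fix c c' :: "'a set \<Rightarrow> 'b"
  show "restrict (c \<otimes>\<^bsub>chain_group X F n\<^esub> c') (nchains Y n) =
      restrict c (nchains Y n) \<otimes>\<^bsub>chain_group Y F n\<^esub> restrict c' (nchains Y n)"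
    using nchains_mono [OF assms(2), of n] by (auto simp: mult_chain_group fun_eq_iff)
qed

text \<open>Turns membership in an image into a condition on single coefficients. The preimage is
  the restriction to \<open>nchains A n\<close>; extending it recovers \<open>c\<close> because
  \<open>c\<close> is extensional on \<open>nchains X n\<close>.\<close>

lemma subchains_iff:
  assumes "ab_functor X F f" "A \<subseteq> X"
  shows "c \<in> subchains X A F n \<longleftrightarrow> c \<in> carrier (chain_group X F n) \<and>
    (\<forall>\<sigma>\<in>nchains X n - nchains A n. c \<sigma> = \<one>\<^bsub>F (chain_min \<sigma>)\<^esub>)"
proof (intro iffI conjI)
  assume "c \<in> subchains X A F n"
  then obtain a where "a \<in> carrier (chain_group A F n)" "c = chain_incl A X F n a"
    by (auto simp: subchains_def)
  then show "c \<in> carrier (chain_group X F n)"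
    "\<forall>\<sigma>\<in>nchains X n - nchains A n. c \<sigma> = \<one>\<^bsub>F (chain_min \<sigma>)\<^esub>"
    using hom_in_carrier [OF chain_incl_hom [OF assms]] by (auto simp: chain_incl_def)
next
  assume c: "c \<in> carrier (chain_group X F n) \<and>
    (\<forall>\<sigma>\<in>nchains X n - nchains A n. c \<sigma> = \<one>\<^bsub>F (chain_min \<sigma>)\<^esub>)"
  then have "c \<in> extensional (nchains X n)"
    by (simp add: carrier_chain_group [OF assms(1)] PiE_iff)
  then have "c = chain_incl A X F n (restrict c (nchains A n))"
    using c by (auto simp: chain_incl_def fun_eq_iff extensional_def)
  then show "c \<in> subchains X A F n"
    unfolding subchains_def using c hom_in_carrier [OF restrict_nchains_hom [OF assms]] by blast
qed

lemma subgroup_subchains: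
  assumes "ab_functor X F f" "A \<subseteq> X"
  shows "subgroup (subchains X A F n) (chain_group X F n)"
proof -
  interpret group_hom "chain_group A F n" "chain_group X F n" "chain_incl A X F n"
    using chain_incl_hom [OF assms] group_chain_group [OF assms(1)]
      group_chain_group [OF ab_functor_subset [OF assms]]
    by (intro group_hom.intro) (simp_all add: group_hom_axioms_def)
  show ?thesis
    unfolding subchains_def by (rule img_is_subgroup)
qed

text \<open>Presents a plain quotient as a subquotient whose subgroup is everything, the shape that
  \<open>coset_map_hom\<close> and \<open>direct_sum_decomposition_subquotient\<close>
  require.\<close>

lemma rel_chain_group_eq:
  assumes "ab_functor X F f"
  shows "rel_chain_group X A F n =
    subgroup_generated (chain_group X F n) (carrier (chain_group X F n)) Mod subchains X A F n"
  by (simp add: rel_chain_group_def group.subgroup_generated_group_carrier group_chain_group [OF assms])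

lemma boundary_subchains:
  assumes "ab_functor X F f" "A \<subseteq> X"
  shows "boundary X F f n ` subchains X A F n \<subseteq> subchains X A F (n - 1)"
  unfolding subchains_def
  using hom_in_carrier [OF boundary_hom [OF ab_functor_subset [OF assms]]]
  by (auto simp flip: chain_incl_boundary [OF assms])

lemma rel_boundary_hom:
  assumes "ab_functor X F f" "A \<subseteq> X"
  shows "rel_boundary X A F f n \<in> hom (rel_chain_group X A F n) (rel_chain_group X A F (n - 1))"
  unfolding rel_boundary_def rel_chain_group_eq [OF assms(1)]
proof (rule coset_map_hom)
  show "boundary X F f n ` carrier (chain_group X F n) \<subseteq> carrier (chain_group X F (n - 1))"
    using hom_carrier [OF boundary_hom [OF assms(1)]] .
qed (rule comm_group_chain_group [OF assms(1)] subgroup_subchains [OF assms] boundary_hom [OF assms(1)]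
    group.subgroup_self [OF group_chain_group [OF assms(1)]] boundary_subchains [OF assms])+

lemma chain_incl_subchains:
  assumes "ab_functor X F f" "Y \<subseteq> X" "A \<subseteq> X" "B \<subseteq> Y" "B \<subseteq> A"
  shows "chain_incl Y X F n ` subchains Y B F n \<subseteq> subchains X A F n"
proof clarify
  fix c assume "c \<in> subchains Y B F n"
  then have c: "c \<in> carrier (chain_group Y F n)"
    "\<forall>\<sigma>\<in>nchains Y n - nchains B n. c \<sigma> = \<one>\<^bsub>F (chain_min \<sigma>)\<^esub>"
    by (auto simp: subchains_iff [OF ab_functor_subset [OF assms(1,2)] assms(4)])
  then show "chain_incl Y X F n c \<in> subchains X A F n"
    using nchains_mono [OF assms(5), of n] hom_in_carrier [OF chain_incl_hom [OF assms(1,2)] c(1)]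
    by (auto simp: subchains_iff [OF assms(1,3)] chain_incl_def)
qed

lemma rel_chain_incl_boundary:
  assumes "ab_functor X F f" "Y \<subseteq> X" "A \<subseteq> X" "B \<subseteq> Y" "B \<subseteq> A"
    and "u \<in> carrier (rel_chain_group Y B F n)"
  shows "rel_boundary X A F f n (rel_chain_incl Y X A F n u)
       = rel_chain_incl Y X A F (n - 1) (rel_boundary Y B F f n u)"
proof -
  note Y = ab_functor_subset [OF assms(1,2)]
  obtain c where c: "c \<in> carrier (chain_group Y F n)" and u: "u = subchains Y B F n #>\<^bsub>chain_group Y F n\<^esub> c"
    using assms(6) by (auto simp: rel_chain_group_def carrier_FactGroup)
  have incl: "rel_chain_incl Y X A F k (subchains Y B F k #>\<^bsub>chain_group Y F k\<^esub> a)
      = subchains X A F k #>\<^bsub>chain_group X F k\<^esub> chain_incl Y X F k a"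
    if "a \<in> carrier (chain_group Y F k)" for k a
    unfolding rel_chain_incl_def using that assms(1-5) Y
    by (intro coset_map_r_coset group_chain_group chain_incl_hom subgroup_subchains chain_incl_subchains) auto
  \<comment> \<open>Stated for an arbitrary pair because it is applied to both \<open>(X, A)\<close>
    and \<open>(Y, B)\<close>. On representatives the claim then reduces to
    \<open>chain_incl_boundary\<close>.\<close>
  have bd: "rel_boundary Z C F f n (subchains Z C F n #>\<^bsub>chain_group Z F n\<^esub> a)
      = subchains Z C F (n - 1) #>\<^bsub>chain_group Z F (n - 1)\<^esub> boundary Z F f n a"
    if "ab_functor Z F f" "C \<subseteq> Z" "a \<in> carrier (chain_group Z F n)" for Z C a
    unfolding rel_boundary_def using that
    by (intro coset_map_r_coset group_chain_group boundary_hom subgroup_subchains boundary_subchains) auto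
  show ?thesis
    using hom_in_carrier [OF chain_incl_hom [OF assms(1,2)] c] hom_in_carrier [OF boundary_hom [OF Y] c]
    by (simp add: u incl bd c Y assms chain_incl_boundary [OF assms(1,2)])
qed

subsection \<open>Decomposition into stars\<close>

lemma star_subset: "star X x \<subseteq> X"
  by (auto simp: star_def)

lemma punctured_star_subset: "punctured_star X x \<subseteq> star X x"
  by (auto simp: punctured_star_def)

text \<open>Modulo chains of the punctured star, a chain of the star is thus determined by its
  coefficients on the simplices through \<open>x\<close>.\<close>

lemma nchains_punctured_star:
  "\<sigma> \<in> nchains (star X x) n \<Longrightarrow> \<sigma> \<in> nchains (punctured_star X x) n \<longleftrightarrow> x \<notin> \<sigma>"
  using nchains_subset [of \<sigma> "star X x" n]
  by (auto simp: nchains_subset_iff [of \<sigma> "star X x"] punctured_star_def)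

lemma nchains_starD: "\<sigma> \<in> nchains (star X x) n \<Longrightarrow> \<sigma> \<in> nchains X n"
  using nchains_mono [OF star_subset] by blast

lemma nchains_star:
  assumes "\<sigma> \<in> nchains X n" "x \<in> \<sigma>"
  shows "\<sigma> \<in> nchains (star X x) n"
  using nchains_subset [OF assms(1)] nchains_total [OF assms(1) assms(2)]
  by (auto simp: nchains_subset_iff [OF assms(1)] star_def)

lemma rel_chain_decomposition:
  assumes F: "ab_functor X F f" and A: "A \<subseteq> X" and anti: "antichain (X - A)"
  shows "direct_sum_decomposition (X - A)
     (\<lambda>x. rel_chain_group (star X x) (punctured_star X x) F n) (rel_chain_group X A F n)
     (\<lambda>x. rel_chain_incl (star X x) X A F n)
     (\<lambda>x. coset_map (chain_group (star X x) F n) (subchains (star X x) (punctured_star X x) F n)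
            (\<lambda>c. restrict c (nchains (star X x) n)))"
proof -
  note star = ab_functor_subset [OF F star_subset]
  note sub_X = subchains_iff [OF F A] and sub_star = subchains_iff [OF star punctured_star_subset]
  note res = hom_in_carrier [OF restrict_nchains_hom [OF F star_subset]]
  note inc = hom_in_carrier [OF chain_incl_hom [OF F star_subset]]
  have eq: "rel_chain_group (star X x) (punctured_star X x) F n =
      subgroup_generated (chain_group (star X x) F n) (carrier (chain_group (star X x) F n))
        Mod subchains (star X x) (punctured_star X x) F n" for x
    by (rule rel_chain_group_eq [OF star])
  show ?thesis
    unfolding rel_chain_incl_def rel_chain_group_eq [OF F] eq
  proof (rule direct_sum_decomposition_subquotient)
    fix x assume x: "x \<in> X - A"
    show "chain_incl (star X x) X F n ` subchains (star X x) (punctured_star X x) F n \<subseteq> subchains X A F n"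
      \<comment> \<open>The antichain hypothesis enters a first time: it puts the punctured star of
        \<open>x\<close> inside \<open>A\<close>.\<close>
      using inclusion_of_pairs [OF A anti x] F A by (intro chain_incl_subchains)
    show "(\<lambda>c. restrict c (nchains (star X x) n)) ` subchains X A F n
        \<subseteq> subchains (star X x) (punctured_star X x) F n"
    proof (clarsimp simp: sub_X sub_star res)
      fix c \<sigma> assume c: "\<forall>\<sigma>\<in>nchains X n - nchains A n. c \<sigma> = \<one>\<^bsub>F (chain_min \<sigma>)\<^esub>"
        and \<sigma>: "\<sigma> \<in> nchains (star X x) n" "\<sigma> \<notin> nchains (punctured_star X x) n"
      then have "x \<in> \<sigma>" "\<sigma> \<in> nchains X n"
        by (auto simp: nchains_punctured_star nchains_starD)
      moreover from this have "\<sigma> \<notin> nchains A n"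
        using x nchains_subset by blast
      ultimately show "c \<sigma> = \<one>\<^bsub>F (chain_min \<sigma>)\<^esub>"
        using c by blast
    qed
    fix u assume u: "u \<in> carrier (chain_group (star X x) F n)"
    then have "u \<in> extensional (nchains (star X x) n)"
      by (simp add: carrier_chain_group [OF star] PiE_iff)
    then show "restrict (chain_incl (star X x) X F n u) (nchains (star X x) n) = u"
      using nchains_mono [OF star_subset, of X x n] by (auto simp: chain_incl_def fun_eq_iff extensional_def)
    show "restrict (chain_incl (star X x) X F n u) (nchains (star X y) n)
        \<in> subchains (star X y) (punctured_star X y) F n" if y: "y \<in> X - A" "x \<noteq> y" for y
    proof (clarsimp simp: sub_star res inc u)
      fix \<sigma> assume \<sigma>: "\<sigma> \<in> nchains (star X y) n" "\<sigma> \<notin> nchains (punctured_star X y) n"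
      then have "y \<in> \<sigma>" "\<sigma> \<in> nchains X n"
        by (auto simp: nchains_punctured_star nchains_starD)
      \<comment> \<open>The antichain hypothesis enters again: distinct points of
        \<open>X - A\<close> are incomparable, so no simplex through \<open>y\<close> lies in the
        star of \<open>x\<close>, and the extension of \<open>u\<close> is trivial there.\<close>
      moreover have "y \<notin> star X x"
        using x y anti by (auto simp: star_def antichain_def)
      ultimately show "chain_incl (star X x) X F n u \<sigma> = \<one>\<^bsub>F (chain_min \<sigma>)\<^esub>"
        using nchains_subset [of \<sigma> "star X x" n] by (auto simp: chain_incl_def)
    qed
  next
    fix c assume c: "c \<in> carrier (chain_group X F n)"
    \<comment> \<open>\<open>S\<close> is the support of \<open>c\<close>. A star on which the
      restriction of \<open>c\<close> is not a subchain has its centre on some simplex of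
      \<open>S\<close>, and finitely many finite simplices have only finitely many points.\<close>
    define S where "S = {\<sigma> \<in> nchains X n. c \<sigma> \<noteq> \<one>\<^bsub>F (chain_min \<sigma>)\<^esub>}"
    have "finite S" "\<And>\<sigma>. \<sigma> \<in> S \<Longrightarrow> finite \<sigma>"
      using c by (auto simp: S_def carrier_chain_group [OF F] nchains_def)
    then have "finite (\<Union>S)"
      by blast
    moreover have "x \<in> \<Union>S"
      if not_sub: "restrict c (nchains (star X x) n) \<notin> subchains (star X x) (punctured_star X x) F n" for x
    proof -
      obtain \<sigma> where "\<sigma> \<in> nchains (star X x) n" "x \<in> \<sigma>" "c \<sigma> \<noteq> \<one>\<^bsub>F (chain_min \<sigma>)\<^esub>"
        using not_sub by (auto simp: sub_star res c nchains_punctured_star)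
      then show ?thesis
        unfolding S_def by (blast dest: nchains_starD)
    qed
    ultimately show "finite {x \<in> X - A. restrict c (nchains (star X x) n)
        \<notin> subchains (star X x) (punctured_star X x) F n}"
      by (rule_tac finite_subset) auto
    assume sub: "\<And>x. x \<in> X - A \<Longrightarrow>
      restrict c (nchains (star X x) n) \<in> subchains (star X x) (punctured_star X x) F n"
    have "c \<sigma> = \<one>\<^bsub>F (chain_min \<sigma>)\<^esub>" if \<sigma>: "\<sigma> \<in> nchains X n" "\<sigma> \<notin> nchains A n" for \<sigma>
    proof -
      \<comment> \<open>Any point of the simplex outside \<open>A\<close> will do: the simplex then
        lies in the star of that point, and the hypothesis \<open>sub\<close> there forces its
        coefficient to be the unit.\<close>
      obtain x where x: "x \<in> \<sigma>" "x \<in> X - A"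
        using \<sigma> nchains_subset [OF \<sigma>(1)] by (auto simp: nchains_subset_iff)
      then have "\<sigma> \<in> nchains (star X x) n" "\<sigma> \<notin> nchains (punctured_star X x) n"
        using nchains_star [OF \<sigma>(1)] by (auto simp: nchains_punctured_star)
      then show ?thesis
        using sub [OF x(2)] by (auto simp: sub_star)
    qed
    then show "c \<in> subchains X A F n"
      using c by (auto simp: sub_X)
  next
    show "(\<lambda>c. restrict c (nchains (star X x) n)) ` carrier (chain_group X F n)
        \<subseteq> carrier (chain_group (star X x) F n)" for x
      by (rule hom_carrier [OF restrict_nchains_hom [OF F star_subset]])
    show "chain_incl (star X x) X F n ` carrier (chain_group (star X x) F n)
        \<subseteq> carrier (chain_group X F n)" for x
      by (rule hom_carrier [OF chain_incl_hom [OF F star_subset]])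
  qed (rule comm_group_chain_group [OF F] comm_group_chain_group [OF star]
      subgroup_subchains [OF F A] subgroup_subchains [OF star punctured_star_subset]
      group.subgroup_self [OF group_chain_group [OF F]] group.subgroup_self [OF group_chain_group [OF star]]
      chain_incl_hom [OF F star_subset] restrict_nchains_hom [OF F star_subset])+
qed

theorem proposition3p4:
  fixes X A :: "'a::order set"
    and F :: "'a \<Rightarrow> 'b monoid"
    and f :: "'a \<Rightarrow> 'a \<Rightarrow> 'b \<Rightarrow> 'b"
    and n :: nat
  assumes "ab_functor X F f"
    and "A \<subseteq> X"
    and "antichain (X - A)"
  shows "(\<lambda>h. gfinprod (rel_homology X A F f (int n))
                (\<lambda>x. rel_homology_incl (star X x) X A F f (int n) (h x))
                (X - A))
         \<in> iso (sum_group (X - A)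
                  (\<lambda>x. rel_homology (star X x) (punctured_star X x) F f (int n)))
               (rel_homology X A F f (int n))"
  unfolding rel_homology_def rel_homology_incl_def
\<comment> \<open>\<open>sum_iso\<close> builds its isomorphism from the inclusions alone. After
  unfolding, these are literally the maps induced by the inclusions of pairs, so the isomorphism
  obtained is the prescribed map and not merely some isomorphism.\<close>
proof (rule direct_sum_decomposition.sum_iso [OF direct_sum_decomposition_homology])
  show "direct_sum_decomposition (X - A)
     (\<lambda>x. rel_chain_group (star X x) (punctured_star X x) F k) (rel_chain_group X A F k)
     (\<lambda>x. rel_chain_incl (star X x) X A F k)
     (\<lambda>x. coset_map (chain_group (star X x) F k) (subchains (star X x) (punctured_star X x) F k)
            (\<lambda>c. restrict c (nchains (star X x) k)))" for k
    using assms by (rule rel_chain_decomposition)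
  show "rel_boundary X A F f k \<in> hom (rel_chain_group X A F k) (rel_chain_group X A F (k - 1))" for k
    using assms(1,2) by (rule rel_boundary_hom)
next
  fix x k u assume x: "x \<in> X - A"
  note pairs = inclusion_of_pairs [OF assms(2,3) x]
  show "rel_boundary (star X x) (punctured_star X x) F f k
      \<in> hom (rel_chain_group (star X x) (punctured_star X x) F k)
            (rel_chain_group (star X x) (punctured_star X x) F (k - 1))"
    by (rule rel_boundary_hom [OF ab_functor_subset [OF assms(1) pairs(1)] pairs(3)])
  assume "u \<in> carrier (rel_chain_group (star X x) (punctured_star X x) F k)"
  then show "rel_boundary X A F f k (rel_chain_incl (star X x) X A F k u)
      = rel_chain_incl (star X x) X A F (k - 1)
          (rel_boundary (star X x) (punctured_star X x) F f k u)"
    using pairs assms by (intro rel_chain_incl_boundary)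
qed

end
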